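(* Let $p>2$ be a prime. Then the group $\mathbb{Z}_p^{2p+3}$ has a Cayley graph of degree $(2p+3)p^{p+1}$ which is not a CI-graph.
   Context: For a finite group $G$ and a subset $S\subseteq G$, the Cayley graph $Cay(G,S)$ is the (directed) graph with vertex set $G$ in which $g$ is joined to $h$ if and only if $gh^{-1}\in S$; its degree is $|S|$. A Cayley graph $Cay(G,S)$ is a CI-graph if for every $T\subseteq G$, the graphs $Cay(G,S)$ and $Cay(G,T)$ are isomorphic if and only if there is a group automorphism $\sigma$ of $G$ with $\sigma(S)=T$. *)

theory Defs
  imports
    "HOL-Algebra.Product_Groups"
    "HOL-Algebra.Elementary_Groups"
    "HOL-Computational_Algebra.Primes"
    "Graph_Theory.Digraph_Isomorphism"
begin

definition cayley_digraph :: "('a, 'm) monoid_scheme \<Rightarrow> 'a set \<Rightarrow> ('a, 'a \<times> 'a) pre_digraph" where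
  "cayley_digraph G S = \<lparr>
     verts = carrier G,
     arcs = {(g, h). g \<in> carrier G \<and> h \<in> carrier G \<and> g \<otimes>\<^bsub>G\<^esub> inv\<^bsub>G\<^esub> h \<in> S},
     tail = fst, head = snd \<rparr>"

definition is_CI_graph :: "('a, 'm) monoid_scheme \<Rightarrow> 'a set \<Rightarrow> bool" where
  "is_CI_graph G S \<longleftrightarrow>
     (\<forall>T \<subseteq> carrier G.
        digraph_iso (cayley_digraph G S) (cayley_digraph G T) \<longleftrightarrow>
        (\<exists>\<sigma> \<in> iso G G. \<sigma> ` S = T))"

definition elem_abelian_group :: "nat \<Rightarrow> nat \<Rightarrow> (nat \<Rightarrow> int) monoid" where
  "elem_abelian_group p n = product_group {..<n} (\<lambda>_. integer_mod_group p)"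

lemma digraph_iso_cayley_digraph_iff:
  "digraph_iso (cayley_digraph G S) (cayley_digraph G T) \<longleftrightarrow>
     (\<exists>f. bij_betw f (carrier G) (carrier G) \<and>
        (\<forall>g \<in> carrier G. \<forall>h \<in> carrier G.
           g \<otimes>\<^bsub>G\<^esub> inv\<^bsub>G\<^esub> h \<in> S \<longleftrightarrow> f g \<otimes>\<^bsub>G\<^esub> inv\<^bsub>G\<^esub> (f h) \<in> T))"
  (is "?L \<longleftrightarrow> ?R")
proof
  let ?A = "\<lambda>S. {(g, h). g \<in> carrier G \<and> h \<in> carrier G \<and> g \<otimes>\<^bsub>G\<^esub> inv\<^bsub>G\<^esub> h \<in> S}"
  assume ?L
  then obtain k where k: "pre_digraph.digraph_isomorphism (cayley_digraph G S) k"
    and eq: "cayley_digraph G T = app_iso k (cayley_digraph G S)"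
    unfolding digraph_iso_def by blast
  define f where "f = iso_verts k"
  have t: "iso_tail k = fst" "iso_head k = snd"
    and v: "f ` carrier G = carrier G" and a: "iso_arcs k ` ?A S = ?A T"
    using eq by (simp_all add: cayley_digraph_def app_iso_def f_def)
  have inj: "inj_on f (carrier G)"
    using k by (simp add: pre_digraph.digraph_isomorphism_def cayley_digraph_def f_def)
  have arc: "iso_arcs k (g, h) = (f g, f h)" if "(g, h) \<in> ?A S" for g h
    using k that t
    by (auto simp: pre_digraph.digraph_isomorphism_def cayley_digraph_def f_def prod_eq_iff)
  have "(\<lambda>(g, h). (f g, f h)) ` ?A S = iso_arcs k ` ?A S"
    by (intro image_cong) (use arc in auto)
  then have im: "(\<lambda>(g, h). (f g, f h)) ` ?A S = ?A T"
    using a by simp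
  show ?R
  proof (intro exI[of _ f] conjI ballI)
    show "bij_betw f (carrier G) (carrier G)"
      using inj v by (simp add: bij_betw_def)
    fix g h assume gh: "g \<in> carrier G" "h \<in> carrier G"
    show "g \<otimes>\<^bsub>G\<^esub> inv\<^bsub>G\<^esub> h \<in> S \<longleftrightarrow> f g \<otimes>\<^bsub>G\<^esub> inv\<^bsub>G\<^esub> (f h) \<in> T"
    proof
      assume "g \<otimes>\<^bsub>G\<^esub> inv\<^bsub>G\<^esub> h \<in> S"
      then have "(f g, f h) \<in> (\<lambda>(g, h). (f g, f h)) ` ?A S"
        using gh by force
      then show "f g \<otimes>\<^bsub>G\<^esub> inv\<^bsub>G\<^esub> (f h) \<in> T"
        unfolding im by simp
    next
      assume "f g \<otimes>\<^bsub>G\<^esub> inv\<^bsub>G\<^esub> (f h) \<in> T"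
      then have "(f g, f h) \<in> ?A T"
        using gh v by auto
      then obtain g' h' where "(g', h') \<in> ?A S" "f g' = f g" "f h' = f h"
        unfolding im[symmetric] by auto
      then show "g \<otimes>\<^bsub>G\<^esub> inv\<^bsub>G\<^esub> h \<in> S"
        using inj gh by (auto dest: inj_onD)
    qed
  qed
next
  assume ?R
  then obtain f where f: "bij_betw f (carrier G) (carrier G)"
    and ar: "\<And>g h. g \<in> carrier G \<Longrightarrow> h \<in> carrier G \<Longrightarrow>
           g \<otimes>\<^bsub>G\<^esub> inv\<^bsub>G\<^esub> h \<in> S \<longleftrightarrow> f g \<otimes>\<^bsub>G\<^esub> inv\<^bsub>G\<^esub> (f h) \<in> T"
    by blast
  let ?A = "\<lambda>S. {(g, h). g \<in> carrier G \<and> h \<in> carrier G \<and> g \<otimes>\<^bsub>G\<^esub> inv\<^bsub>G\<^esub> h \<in> S}"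
  have inj: "inj_on f (carrier G)" and v: "f ` carrier G = carrier G"
    using f by (auto simp: bij_betw_def)
  have im: "map_prod f f ` ?A S = ?A T"
  proof (intro equalityI subsetI)
    fix x assume "x \<in> map_prod f f ` ?A S"
    then show "x \<in> ?A T" using v ar by auto
  next
    fix x assume x: "x \<in> ?A T"
    then have "fst x \<in> f ` carrier G" "snd x \<in> f ` carrier G"
      unfolding v by auto
    then obtain g h where "x = (f g, f h)" "g \<in> carrier G" "h \<in> carrier G"
      by (metis imageE prod.collapse)
    then show "x \<in> map_prod f f ` ?A S"
      using ar x by force
  qed
  let ?k = "\<lparr>iso_verts = f, iso_arcs = map_prod f f, iso_head = snd, iso_tail = fst\<rparr>"
  have "wf_digraph (cayley_digraph G S)"
    by unfold_locales (auto simp: cayley_digraph_def)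
  moreover have "inj_on (map_prod f f) (?A S)"
    using inj by (auto simp: inj_on_def)
  ultimately have "pre_digraph.digraph_isomorphism (cayley_digraph G S) ?k"
    using inj by (simp add: pre_digraph.digraph_isomorphism_def cayley_digraph_def)
  moreover have "cayley_digraph G T = app_iso ?k (cayley_digraph G S)"
    using im v by (simp add: cayley_digraph_def app_iso_def)
  ultimately show ?L
    unfolding digraph_iso_def by blast
qed

end

theory Submission
  imports Defs
begin

text \<open>
  Write the elements of \<open>\<int>\<^sub>p\<^bsup>2p+3\<^esup>\<close> as \<open>(x\<^sub>0, \<dots>, x\<^sub>p, z\<^sub>0, \<dots>, z\<^sub>p, Z)\<close>, let \<open>e\<^sub>i\<close> be the unit
  vectors of the base \<open>\<int>\<^sub>p\<^bsup>p+1\<^esup>\<close> and \<open>s\<close> their sum. For \<open>c \<in> \<int>\<^sub>p\<close> the connection set \<open>S\<^sub>c\<close> consists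
  of \<open>2p + 3\<close> affine hyperplanes in fibres over the base: \<open>z\<^sub>i = 0\<close> over \<open>e\<^sub>i\<close>, \<open>Z = z\<^sub>i\<close> over
  \<open>s - e\<^sub>i\<close>, and \<open>z\<^sub>0 + \<dots> + z\<^sub>p = c\<close> over \<open>s\<close>.

  The graphs of \<open>S\<^sub>0\<close> and \<open>S\<^sub>1\<close> are isomorphic: representing residues by \<open>0, \<dots>, p - 1\<close>, add the carry
  \<open>(\<Sum>j\<noteq>i. x\<^sub>j) div p\<close> to \<open>z\<^sub>i\<close> and \<open>(\<Sum>j. x\<^sub>j) div p\<close> to \<open>Z\<close>. The carry in \<open>z\<^sub>i\<close> does not change under a
  step \<open>e\<^sub>i\<close>, the carries in \<open>Z\<close> and \<open>z\<^sub>i\<close> change equally under \<open>s - e\<^sub>i\<close>, and the sum of the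
  carries in the \<open>z\<^sub>i\<close> increases by \<open>1\<close> modulo \<open>p\<close> under \<open>s\<close>.

  No automorphism \<open>\<sigma>\<close> maps \<open>S\<^sub>0\<close> to \<open>S\<^sub>1\<close>. The base points lie in \<open>{0,1}\<^bsup>p+1\<^esup>\<close>, which contains no
  three-term progression for \<open>p > 2\<close>, so \<open>\<sigma>\<close> preserves the fibre over \<open>0\<close>. Hence \<open>\<sigma>\<close> maps the subgroup
  \<open>z = 0, Z = 0\<close> to a complement of that fibre which meets every hyperplane of \<open>S\<^sub>1\<close>, say in points
  \<open>k(e\<^sub>i)\<close>, \<open>k(s - e\<^sub>i)\<close>, \<open>k(s)\<close> with \<open>k(s) = \<Sum>i. k(e\<^sub>i) = k(s - e\<^sub>i) + k(e\<^sub>i)\<close>. Then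
  \<open>z\<^sub>i(k(s)) = z\<^sub>i(k(s - e\<^sub>i)) = Z(k(s - e\<^sub>i)) = Z(k(s)) - Z(k(e\<^sub>i))\<close>, and summing over \<open>i\<close> gives
  \<open>1 = (p + 1) Z(k(s)) - Z(k(s)) = 0\<close> in \<open>\<int>\<^sub>p\<close>.
\<close>

section \<open>Coordinates in the elementary abelian group\<close>

lemma carrier_elem_abelian_group:
  "p > 0 \<Longrightarrow> carrier (elem_abelian_group p n) = {..<n} \<rightarrow>\<^sub>E {0..<int p}"
  by (simp add: elem_abelian_group_def carrier_integer_mod_group)

lemma elem_abelian_group_nth:
  assumes "p > 0" "x \<in> carrier (elem_abelian_group p n)" "j < n"
  shows "0 \<le> x j" "x j < int p"
  using assms by (auto simp: carrier_elem_abelian_group PiE_iff)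

lemma elem_abelian_group_eqI:
  assumes "p > 0" "x \<in> carrier (elem_abelian_group p n)" "y \<in> carrier (elem_abelian_group p n)"
    and "\<And>j. j < n \<Longrightarrow> x j = y j"
  shows "x = y"
  using assms by (intro PiE_ext[of x "{..<n}" _ y]) (auto simp: carrier_elem_abelian_group)

lemma finite_carrier_elem_abelian_group:
  "p > 0 \<Longrightarrow> finite (carrier (elem_abelian_group p n))"
  by (simp add: carrier_elem_abelian_group finite_PiE)

lemma group_elem_abelian_group: "group (elem_abelian_group p n)"
  by (simp add: elem_abelian_group_def)

lemma mult_elem_abelian_group:
  "x \<otimes>\<^bsub>elem_abelian_group p n\<^esub> y = (\<lambda>j\<in>{..<n}. (x j + y j) mod int p)"
  by (simp add: elem_abelian_group_def)

lemma one_elem_abelian_group: "\<one>\<^bsub>elem_abelian_group p n\<^esub> = (\<lambda>j\<in>{..<n}. 0)"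
  by (simp add: elem_abelian_group_def)

lemma diff_elem_abelian_group:
  assumes "x \<in> carrier (elem_abelian_group p n)" "y \<in> carrier (elem_abelian_group p n)"
  shows "x \<otimes>\<^bsub>elem_abelian_group p n\<^esub> inv\<^bsub>elem_abelian_group p n\<^esub> y
    = (\<lambda>j\<in>{..<n}. (x j - y j) mod int p)"
proof -
  have "inv\<^bsub>elem_abelian_group p n\<^esub> y = (\<lambda>j\<in>{..<n}. (- y j) mod int p)"
    using assms by (auto simp: elem_abelian_group_def PiE_iff intro!: restrict_ext)
  then show ?thesis
    by (auto simp: mult_elem_abelian_group mod_add_right_eq)
qed

text \<open>Induction on the index set, with the sum written out in coordinates. The intended
  \<open>K\<close> is the image of a subgroup, which must contain the sum of its points over the
  unit vectors.\<close>

lemma sum_mem_of_mult_closed: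
  assumes one: "\<one>\<^bsub>elem_abelian_group p n\<^esub> \<in> K"
    and mult: "\<And>x y. x \<in> K \<Longrightarrow> y \<in> K \<Longrightarrow> x \<otimes>\<^bsub>elem_abelian_group p n\<^esub> y \<in> K"
    and "finite I" and k: "\<And>i. i \<in> I \<Longrightarrow> k i \<in> K"
  shows "(\<lambda>j\<in>{..<n}. (\<Sum>i\<in>I. k i j) mod int p) \<in> K"
  using \<open>finite I\<close> k
proof (induction I)
  case empty
  then show ?case using one by (simp add: one_elem_abelian_group restrict_def)
next
  case (insert i I)
  have "k i \<otimes>\<^bsub>elem_abelian_group p n\<^esub> (\<lambda>j\<in>{..<n}. (\<Sum>i\<in>I. k i j) mod int p) \<in> K"
    using insert.prems by (intro mult insert.IH) auto
  also have "k i \<otimes>\<^bsub>elem_abelian_group p n\<^esub> (\<lambda>j\<in>{..<n}. (\<Sum>i\<in>I. k i j) mod int p)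
      = (\<lambda>j\<in>{..<n}. (\<Sum>i\<in>insert i I. k i j) mod int p)"
    using insert.hyps by (auto simp: mult_elem_abelian_group mod_add_right_eq)
  finally show ?case .
qed

text \<open>Common shape of all the fibres: the base coordinates are prescribed and a linear
  equation is solved for coordinate \<open>k\<close>. The remaining \<open>n - m - 1\<close>
  coordinates are free, and restricting to them is a bijection.\<close>

lemma card_functions_with_determined_coordinates:
  fixes p n m k :: nat and a :: "nat \<Rightarrow> int"
  assumes k: "m \<le> k" "k < n"
    and a: "\<And>j. j < m \<Longrightarrow> a j \<in> {0..<int p}"
    and F: "\<And>x. F x \<in> {0..<int p}"
    and F_cong: "\<And>x y. (\<And>j. m \<le> j \<Longrightarrow> j < n \<Longrightarrow> j \<noteq> k \<Longrightarrow> x j = y j) \<Longrightarrow> F x = F y"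
  shows "card {x \<in> {..<n} \<rightarrow>\<^sub>E {0..<int p}. (\<forall>j<m. x j = a j) \<and> x k = F x} = p ^ (n - m - 1)"
    (is "card ?X = _")
proof -
  define J where "J = {m..<n} - {k}"
  have Fr: "F (restrict x J) = F x" for x
    by (rule F_cong) (auto simp: J_def)
  \<comment> \<open>The inverse of the restriction to \<open>J\<close>. It is not circular, since
    \<open>F\<close> looks only at coordinates in \<open>J\<close>.\<close>
  define g where "g y = (\<lambda>j\<in>{..<n}. if j < m then a j else if j = k then F y else y j)" for y
  have Fg: "F (g y) = F y" for y
    by (rule F_cong) (auto simp: g_def)
  have "bij_betw (\<lambda>x. restrict x J) ?X (J \<rightarrow>\<^sub>E {0..<int p})"
  proof (rule bij_betw_byWitness[where f' = g])
    show "\<forall>x\<in>?X. g (restrict x J) = x"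
    proof
      fix x assume x: "x \<in> ?X"
      show "g (restrict x J) = x"
      proof
        fix j show "g (restrict x J) j = x j"
          using x by (auto simp: g_def Fr[unfolded J_def] J_def PiE_iff extensional_def)
      qed
    qed
    show "\<forall>y\<in>J \<rightarrow>\<^sub>E {0..<int p}. restrict (g y) J = y"
    proof
      fix y assume y: "y \<in> J \<rightarrow>\<^sub>E {0..<int p}"
      show "restrict (g y) J = y"
      proof
        fix j show "restrict (g y) J j = y j"
          using y by (auto simp: g_def J_def PiE_iff extensional_def)
      qed
    qed
    show "(\<lambda>x. restrict x J) ` ?X \<subseteq> J \<rightarrow>\<^sub>E {0..<int p}"
    proof
      fix y assume "y \<in> (\<lambda>x. restrict x J) ` ?X"
      then obtain x where "x \<in> ?X" "y = restrict x J" by blast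
      then show "y \<in> J \<rightarrow>\<^sub>E {0..<int p}"
        by (auto simp: J_def PiE_iff extensional_def split: if_splits)
    qed
    have "g y \<in> ?X" if y: "y \<in> J \<rightarrow>\<^sub>E {0..<int p}" for y
    proof -
      have "g y j \<in> {0..<int p}" if "j < n" for j
        using that a[of j] F[of y] y by (auto simp: g_def PiE_iff J_def)
      moreover have "g y k = F (g y)" using k by (simp add: Fg) (simp add: g_def)
      ultimately show ?thesis
        using k by (auto simp: PiE_iff g_def)
    qed
    then show "g ` (J \<rightarrow>\<^sub>E {0..<int p}) \<subseteq> ?X" by blast
  qed
  then have "card ?X = card (J \<rightarrow>\<^sub>E {0..<int p})" by (rule bij_betw_same_card)
  also have "\<dots> = p ^ (n - m - 1)"
    using k by (simp add: card_PiE J_def)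
  finally show ?thesis .
qed

section \<open>The connection sets and their size\<close>

definition base_unit :: "nat \<Rightarrow> nat \<Rightarrow> int" where
  "base_unit i j = of_bool (j = i)"

definition base_counit :: "nat \<Rightarrow> nat \<Rightarrow> int" where
  "base_counit i j = of_bool (j \<noteq> i)"

text \<open>The coordinates \<open>x\<^sub>i\<close>, \<open>z\<^sub>i\<close> and \<open>Z\<close> have indices \<open>i\<close>, \<open>p + 1 + i\<close> and \<open>2p + 2\<close>.\<close>

definition unit_fibre :: "nat \<Rightarrow> nat \<Rightarrow> (nat \<Rightarrow> int) set" where
  "unit_fibre p i = {x \<in> carrier (elem_abelian_group p (2 * p + 3)).
     (\<forall>j<p + 1. x j = base_unit i j) \<and> x (p + 1 + i) = 0}"

definition counit_fibre :: "nat \<Rightarrow> nat \<Rightarrow> (nat \<Rightarrow> int) set" where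
  "counit_fibre p i = {x \<in> carrier (elem_abelian_group p (2 * p + 3)).
     (\<forall>j<p + 1. x j = base_counit i j) \<and> x (2 * p + 2) = x (p + 1 + i)}"

definition ones_fibre :: "nat \<Rightarrow> int \<Rightarrow> (nat \<Rightarrow> int) set" where
  "ones_fibre p c = {x \<in> carrier (elem_abelian_group p (2 * p + 3)).
     (\<forall>j<p + 1. x j = 1) \<and> (\<Sum>i<p + 1. x (p + 1 + i)) mod int p = c}"

definition connection_set :: "nat \<Rightarrow> int \<Rightarrow> (nat \<Rightarrow> int) set" where
  "connection_set p c =
     (\<Union>i<p + 1. unit_fibre p i) \<union> (\<Union>i<p + 1. counit_fibre p i) \<union> ones_fibre p c"

lemma connection_set_subset: "connection_set p c \<subseteq> carrier (elem_abelian_group p (2 * p + 3))"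
  by (auto simp: connection_set_def unit_fibre_def counit_fibre_def ones_fibre_def)

text \<open>There are \<open>p + 1 \<ge> 3\<close> base coordinates, so some index differs from both
  \<open>i\<close> and \<open>i'\<close>; there one vector is 0 and the other is 1.\<close>

lemma base_unit_neq_counit:
  assumes "p > 1" "\<And>j. j < p + 1 \<Longrightarrow> base_unit i j = base_counit i' j"
  shows False
proof -
  have "\<exists>j<p + 1. j \<noteq> i \<and> j \<noteq> i'"
  proof (rule ccontr)
    assume "\<not> ?thesis"
    then have "{..<p + 1} \<subseteq> {i, i'}" by blast
    then have "card {..<p + 1} \<le> card {i, i'}" by (intro card_mono) auto
    also have "\<dots> \<le> 2" by (simp add: card_insert_if)
    finally show False using assms by simp
  qed
  then obtain j where "j < p + 1" "j \<noteq> i" "j \<noteq> i'" by blast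
  then show False using assms(2)[of j] by (simp add: base_unit_def base_counit_def)
qed

lemma base_unit_neq_ones:
  assumes "p > 0" "\<And>j. j < p + 1 \<Longrightarrow> base_unit i j = 1"
  shows False
  using assms(2)[of 0] assms(2)[of 1] assms(1) by (auto simp: base_unit_def split: if_splits)

text \<open>The \<open>2 * p + 3\<close> fibres lie over distinct base points, so they are disjoint,
  and each has \<open>p ^ (p + 1)\<close> elements.\<close>

lemma card_connection_set:
  assumes "p > 1"
  shows "card (connection_set p 0) = (2 * p + 3) * p ^ (p + 1)"
proof -
  let ?G = "elem_abelian_group p (2 * p + 3)"
  have e: "2 * p + 3 - (p + 1) - 1 = p + 1" by simp
  have carr: "carrier ?G = {..<2 * p + 3} \<rightarrow>\<^sub>E {0..<int p}"
    using assms by (simp add: carrier_elem_abelian_group)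
  have unit: "card (unit_fibre p i) = p ^ (p + 1)" if "i < p + 1" for i
    unfolding unit_fibre_def carr
    by (subst card_functions_with_determined_coordinates)
       (use that assms e in \<open>auto simp: base_unit_def\<close>)
  have counit: "card (counit_fibre p i) = p ^ (p + 1)" if "i < p + 1" for i
  proof -
    \<comment> \<open>The extra \<open>mod int p\<close> changes nothing on the carrier, but puts
      the determined value in range for every function \<open>x\<close>, as the counting lemma
      demands.\<close>
    have "counit_fibre p i = {x \<in> {..<2 * p + 3} \<rightarrow>\<^sub>E {0..<int p}.
        (\<forall>j<p + 1. x j = base_counit i j) \<and> x (2 * p + 2) = x (p + 1 + i) mod int p}"
      unfolding counit_fibre_def carr
      using that by (intro Collect_cong conj_cong refl) (auto simp: PiE_iff)
    also have "card \<dots> = p ^ (2 * p + 3 - (p + 1) - 1)"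
      by (rule card_functions_with_determined_coordinates)
         (use that assms in \<open>auto simp: base_counit_def\<close>)
    finally show ?thesis by (simp only: e)
  qed
  have ones: "card (ones_fibre p 0) = p ^ (p + 1)"
  proof -
    \<comment> \<open>The equation is solved for the first fibre coordinate, index
      \<open>p + 1\<close>.\<close>
    have *: "(\<Sum>i<p + 1. x (p + 1 + i)) mod int p = 0 \<longleftrightarrow>
        x (p + 1) = (- (\<Sum>i<p. x (p + 2 + i))) mod int p"
      if "x (p + 1) \<in> {0..<int p}" for x :: "nat \<Rightarrow> int"
    proof -
      let ?r = "\<Sum>i<p. x (p + 2 + i)"
      have s: "(\<Sum>i<p + 1. x (p + 1 + i)) = x (p + 1) - (- ?r)"
        using sum.lessThan_Suc_shift[of "\<lambda>i. x (p + 1 + i)" p] by simp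
      have "(\<Sum>i<p + 1. x (p + 1 + i)) mod int p = 0 \<longleftrightarrow> x (p + 1) mod int p = (- ?r) mod int p"
        unfolding s mod_eq_dvd_iff by (simp add: dvd_eq_mod_eq_0)
      then show ?thesis using that by simp
    qed
    have "ones_fibre p 0 = {x \<in> {..<2 * p + 3} \<rightarrow>\<^sub>E {0..<int p}.
        (\<forall>j<p + 1. x j = 1) \<and> x (p + 1) = (- (\<Sum>i<p. x (p + 2 + i))) mod int p}"
      unfolding ones_fibre_def carr
      by (intro Collect_cong conj_cong refl *) (auto simp: PiE_iff)
    also have "card \<dots> = p ^ (2 * p + 3 - (p + 1) - 1)"
    proof (rule card_functions_with_determined_coordinates)
      fix x y :: "nat \<Rightarrow> int"
      assume "\<And>j. p + 1 \<le> j \<Longrightarrow> j < 2 * p + 3 \<Longrightarrow> j \<noteq> p + 1 \<Longrightarrow> x j = y j"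
      then have "(\<Sum>i<p. x (p + 2 + i)) = (\<Sum>i<p. y (p + 2 + i))" by (intro sum.cong) auto
      then show "(- (\<Sum>i<p. x (p + 2 + i))) mod int p = (- (\<Sum>i<p. y (p + 2 + i))) mod int p"
        by simp
    qed (use assms in auto)
    finally show ?thesis by (simp only: e)
  qed
  have fin: "finite X" if "X \<subseteq> carrier ?G" for X
    using that finite_carrier_elem_abelian_group assms finite_subset by (metis less_trans zero_less_one)
  have fins: "finite (unit_fibre p i)" "finite (counit_fibre p i)" "finite (ones_fibre p 0)" for i
    by (auto intro!: fin simp: unit_fibre_def counit_fibre_def ones_fibre_def)
  have U: "card (\<Union>i<p + 1. unit_fibre p i) = (p + 1) * p ^ (p + 1)"
  proof (subst card_UN_disjoint)
    show "\<forall>i\<in>{..<p + 1}. \<forall>j\<in>{..<p + 1}. i \<noteq> j \<longrightarrow> unit_fibre p i \<inter> unit_fibre p j = {}"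
      by (force simp: unit_fibre_def base_unit_def)
  qed (use fins unit in auto)
  have C: "card (\<Union>i<p + 1. counit_fibre p i) = (p + 1) * p ^ (p + 1)"
  proof (subst card_UN_disjoint)
    show "\<forall>i\<in>{..<p + 1}. \<forall>j\<in>{..<p + 1}. i \<noteq> j \<longrightarrow> counit_fibre p i \<inter> counit_fibre p j = {}"
      by (force simp: counit_fibre_def base_counit_def)
  qed (use fins counit in auto)
  have UC: "(\<Union>i<p + 1. unit_fibre p i) \<inter> (\<Union>i<p + 1. counit_fibre p i) = {}"
    using base_unit_neq_counit[OF assms] by (fastforce simp: unit_fibre_def counit_fibre_def)
  have O: "((\<Union>i<p + 1. unit_fibre p i) \<union> (\<Union>i<p + 1. counit_fibre p i)) \<inter> ones_fibre p 0 = {}"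
  proof -
    have "x \<notin> ones_fibre p 0" if "x \<in> unit_fibre p i" for x i
      using that base_unit_neq_ones[of p i] assms by (auto simp: unit_fibre_def ones_fibre_def)
    moreover have "x \<notin> ones_fibre p 0" if "x \<in> counit_fibre p i" "i < p + 1" for x i
      using that by (auto simp: counit_fibre_def ones_fibre_def base_counit_def)
    ultimately show ?thesis by blast
  qed
  have "card (connection_set p 0) = (p + 1) * p ^ (p + 1) + (p + 1) * p ^ (p + 1) + p ^ (p + 1)"
    unfolding connection_set_def
    using fins U C UC O ones by (subst card_Un_disjoint; (subst card_Un_disjoint)?) auto
  also have "\<dots> = (2 * p + 3) * p ^ (p + 1)" by (simp add: algebra_simps)
  finally show ?thesis .
qed


section \<open>The carry twist as a graph isomorphism\<close>

definition partial_carry :: "nat \<Rightarrow> nat \<Rightarrow> (nat \<Rightarrow> int) \<Rightarrow> int" where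
  "partial_carry p i x = (\<Sum>j\<in>{..<p + 1} - {i}. x j) div int p"

definition total_carry :: "nat \<Rightarrow> (nat \<Rightarrow> int) \<Rightarrow> int" where
  "total_carry p x = (\<Sum>j<p + 1. x j) div int p"

definition twist :: "nat \<Rightarrow> (nat \<Rightarrow> int) \<Rightarrow> nat \<Rightarrow> int" where
  "twist p x = (\<lambda>j\<in>{..<2 * p + 3}.
     if j < p + 1 then x j
     else if j < 2 * p + 2 then (x j + partial_carry p (j - (p + 1)) x) mod int p
     else (x j + total_carry p x) mod int p)"

lemma twist_base: "j < p + 1 \<Longrightarrow> twist p x j = x j"
  and twist_partial: "i < p + 1 \<Longrightarrow>
    twist p x (p + 1 + i) = (x (p + 1 + i) + partial_carry p i x) mod int p"
  and twist_total: "twist p x (2 * p + 2) = (x (2 * p + 2) + total_carry p x) mod int p"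
  by (auto simp: twist_def)

lemma carry_cong:
  assumes "\<And>j. j < p + 1 \<Longrightarrow> x j = y j"
  shows "partial_carry p i x = partial_carry p i y" "total_carry p x = total_carry p y"
  using assms by (auto simp: partial_carry_def total_carry_def intro!: arg_cong2[of _ _ _ _ "(div)"] sum.cong)

lemma mod_add_right_cancel_int:
  assumes "(a + c) mod m = (b + c) mod m" "a \<in> {0..<m}" "b \<in> {0..<m}"
  shows "a = (b :: int)"
proof -
  have "a mod m = b mod m" using assms(1) by (simp add: mod_eq_dvd_iff)
  then show ?thesis using assms by simp
qed

text \<open>The twist fixes the base coordinates and translates the others by amounts depending only
  on the base. Hence it is injective, and surjective by finiteness.\<close>

lemma bij_betw_twist:
  assumes "p > 0"
  shows "bij_betw (twist p) (carrier (elem_abelian_group p (2 * p + 3)))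
           (carrier (elem_abelian_group p (2 * p + 3)))"
proof -
  let ?G = "elem_abelian_group p (2 * p + 3)"
  have sub: "twist p ` carrier ?G \<subseteq> carrier ?G"
  proof
    fix y assume "y \<in> twist p ` carrier ?G"
    then obtain x where x: "x \<in> carrier ?G" and y: "y = twist p x" by blast
    have "twist p x j \<in> {0..<int p}" if "j < 2 * p + 3" for j
      using elem_abelian_group_nth[OF assms x that] that assms by (simp add: twist_def)
    then show "y \<in> carrier ?G"
      unfolding y carrier_elem_abelian_group[OF assms] by (simp add: PiE_iff) (simp add: twist_def)
  qed
  have inj: "inj_on (twist p) (carrier ?G)"
  proof (rule inj_onI)
    fix x y assume x: "x \<in> carrier ?G" and y: "y \<in> carrier ?G" and eq: "twist p x = twist p y"
    have base: "x j = y j" if "j < p + 1" for j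
      using eq that by (metis twist_base)
    note carry = carry_cong[of p x y, OF base]
    have range: "x j \<in> {0..<int p}" "y j \<in> {0..<int p}" if "j < 2 * p + 3" for j
      using elem_abelian_group_nth[OF assms x that] elem_abelian_group_nth[OF assms y that] by auto
    have "x j = y j" if j: "j < 2 * p + 3" for j
    proof -
      consider "j < p + 1" | "\<not> j < p + 1" "j < 2 * p + 2" | "j = 2 * p + 2" using j by linarith
      then show ?thesis
      proof cases
        case 2
        then have "(x j + partial_carry p (j - (p + 1)) y) mod int p
            = (y j + partial_carry p (j - (p + 1)) y) mod int p"
          using fun_cong[OF eq, of j] carry by (simp add: twist_def)
        then show ?thesis by (rule mod_add_right_cancel_int) (use range j in auto)
      next
        case 3
        then have "(x j + total_carry p y) mod int p = (y j + total_carry p y) mod int p"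
          using fun_cong[OF eq, of j] carry by (simp add: twist_def)
        then show ?thesis by (rule mod_add_right_cancel_int) (use range j in auto)
      qed (rule base)
    qed
    then show "x = y" by (intro elem_abelian_group_eqI[OF assms x y])
  qed
  show ?thesis
    using inj endo_inj_surj[OF finite_carrier_elem_abelian_group[OF assms] sub inj]
    by (simp add: bij_betw_def)
qed

text \<open>\<open>d\<close> and \<open>d'\<close> are the differences of \<open>g\<close> and
  \<open>h\<close> before and after the twist. They share their base point, so the fibres can be
  compared one at a time.\<close>

lemma twist_connection_set:
  fixes p :: nat
  assumes p: "p > 1"
    and g: "g \<in> carrier (elem_abelian_group p (2 * p + 3))"
    and h: "h \<in> carrier (elem_abelian_group p (2 * p + 3))"
  defines "d \<equiv> \<lambda>j\<in>{..<2 * p + 3}. (g j - h j) mod int p"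
    and "d' \<equiv> \<lambda>j\<in>{..<2 * p + 3}. (twist p g j - twist p h j) mod int p"
  shows "d \<in> connection_set p 0 \<longleftrightarrow> d' \<in> connection_set p 1"
proof -
  let ?G = "elem_abelian_group p (2 * p + 3)"
  have carr: "d \<in> carrier ?G" "d' \<in> carrier ?G"
    using p by (auto simp: d_def d'_def carrier_elem_abelian_group)
  have base: "d' j = d j" if "j < p + 1" for j
    using that by (simp add: d_def d'_def twist_base)
  have part: "d' (p + 1 + i) = (d (p + 1 + i) + (partial_carry p i g - partial_carry p i h)) mod int p"
    if "i < p + 1" for i
  proof -
    have "d' (p + 1 + i) = (twist p g (p + 1 + i) - twist p h (p + 1 + i)) mod int p"
      using that by (simp add: d'_def)
    also have "\<dots> = ((g (p + 1 + i) + partial_carry p i g) - (h (p + 1 + i) + partial_carry p i h)) mod int p"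
      unfolding twist_partial[OF that] by (rule mod_diff_eq)
    also have "\<dots> = ((g (p + 1 + i) - h (p + 1 + i)) + (partial_carry p i g - partial_carry p i h)) mod int p"
      by (simp add: algebra_simps)
    also have "\<dots> = (d (p + 1 + i) + (partial_carry p i g - partial_carry p i h)) mod int p"
      using that by (simp add: d_def mod_add_left_eq)
    finally show ?thesis .
  qed
  have tot: "d' (2 * p + 2) = (d (2 * p + 2) + (total_carry p g - total_carry p h)) mod int p"
  proof -
    have "d' (2 * p + 2) = (twist p g (2 * p + 2) - twist p h (2 * p + 2)) mod int p"
      by (simp add: d'_def)
    also have "\<dots> = ((g (2 * p + 2) + total_carry p g) - (h (2 * p + 2) + total_carry p h)) mod int p"
      unfolding twist_total by (rule mod_diff_eq)
    also have "\<dots> = ((g (2 * p + 2) - h (2 * p + 2)) + (total_carry p g - total_carry p h)) mod int p"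
      by (simp add: algebra_simps)
    also have "\<dots> = (d (2 * p + 2) + (total_carry p g - total_carry p h)) mod int p"
      by (simp add: d_def mod_add_left_eq)
    finally show ?thesis .
  qed
  have d_range: "d j \<in> {0..<int p}" if "j < 2 * p + 3" for j
    using that p by (simp add: d_def)
  \<comment> \<open>For base coordinates \<open>m j\<close> is 0 or -1: it is minus the borrow in
    subtracting \<open>h j\<close> from \<open>g j\<close>.\<close>
  define m where "m j = (g j - h j) div int p" for j
  have gm: "g j = (h j + d j) + int p * m j" if "j < p + 1" for j
    using that by (simp add: d_def m_def)
  have m0: "m j = 0" if "j < p + 1" "d j = 0" for j
  proof -
    have "0 \<le> g j" "g j < int p" "0 \<le> h j" "h j < int p"
      using elem_abelian_group_nth[of p] p g h that by auto
    moreover have "g j mod int p = h j mod int p"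
      using that by (simp add: d_def mod_eq_dvd_iff dvd_eq_mod_eq_0)
    ultimately have "g j = h j" by simp
    then show ?thesis by (simp add: m_def)
  qed
  \<comment> \<open>When the \<open>d j\<close> sum to a multiple of \<open>p\<close>, the two
    integer sums differ by a multiple of \<open>p\<close>, so the floors differ exactly by the
    quotient.\<close>
  have pc: "partial_carry p i g - partial_carry p i h = k + (\<Sum>j\<in>{..<p + 1} - {i}. m j)"
    if "(\<Sum>j\<in>{..<p + 1} - {i}. d j) = int p * k" for i k
  proof -
    have "(\<Sum>j\<in>{..<p + 1} - {i}. g j) = (\<Sum>j\<in>{..<p + 1} - {i}. (h j + d j) + int p * m j)"
      by (intro sum.cong) (auto simp: gm)
    also have "\<dots> = (\<Sum>j\<in>{..<p + 1} - {i}. h j) + int p * (k + (\<Sum>j\<in>{..<p + 1} - {i}. m j))"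
      by (simp only: sum.distrib that sum_distrib_left[symmetric] distrib_left add.assoc)
    finally show ?thesis using p by (simp add: partial_carry_def)
  qed
  have tc: "total_carry p g - total_carry p h = k + (\<Sum>j<p + 1. m j)"
    if "(\<Sum>j<p + 1. d j) = int p * k" for k
  proof -
    have "(\<Sum>j<p + 1. g j) = (\<Sum>j<p + 1. (h j + d j) + int p * m j)"
      by (intro sum.cong) (auto simp: gm)
    also have "\<dots> = (\<Sum>j<p + 1. h j) + int p * (k + (\<Sum>j<p + 1. m j))"
      by (simp only: sum.distrib that sum_distrib_left[symmetric] distrib_left add.assoc)
    finally show ?thesis using p by (simp add: total_carry_def)
  qed
  have remove: "(\<Sum>j<p + 1. f j) = f i + (\<Sum>j\<in>{..<p + 1} - {i}. f j)"
    if "i < p + 1" for f :: "nat \<Rightarrow> int" and i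
    using that by (intro sum.remove) auto

  have unit: "d \<in> unit_fibre p i \<longleftrightarrow> d' \<in> unit_fibre p i" if i: "i < p + 1" for i
  proof -
    have "d' (p + 1 + i) = d (p + 1 + i)" if b: "\<forall>j<p + 1. d j = base_unit i j"
    proof -
      \<comment> \<open>Over a unit vector the other coordinates do not move, so there are no
        borrows and the carry is unchanged.\<close>
      have "(\<Sum>j\<in>{..<p + 1} - {i}. d j) = int p * 0" "(\<Sum>j\<in>{..<p + 1} - {i}. m j) = 0"
        using b m0 by (auto intro!: sum.neutral simp: base_unit_def)
      then show ?thesis using part[OF i] pc[of i 0] d_range[of "p + 1 + i"] i by simp
    qed
    then show ?thesis using carr base by (auto simp: unit_fibre_def)
  qed
  have counit: "d \<in> counit_fibre p i \<longleftrightarrow> d' \<in> counit_fibre p i" if i: "i < p + 1" for i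
  proof -
    have "d' (2 * p + 2) = d' (p + 1 + i) \<longleftrightarrow> d (2 * p + 2) = d (p + 1 + i)"
      if b: "\<forall>j<p + 1. d j = base_counit i j"
    proof -
      have "(\<Sum>j\<in>{..<p + 1} - {i}. d j) = (\<Sum>j\<in>{..<p + 1} - {i}. 1)"
        using b by (intro sum.cong) (auto simp: base_counit_def)
      then have s: "(\<Sum>j\<in>{..<p + 1} - {i}. d j) = int p * 1" using i by simp
      have di: "d i = 0" using b i by (simp add: base_counit_def)
      \<comment> \<open>Coordinate \<open>i\<close> does not move and has no borrow, so the total
        carry and the partial carry change by the same amount.\<close>
      have "(\<Sum>j<p + 1. d j) = int p * 1" "(\<Sum>j<p + 1. m j) = (\<Sum>j\<in>{..<p + 1} - {i}. m j)"
        using remove[OF i, of d] remove[OF i, of m] s di m0[OF i] by auto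
      then have "total_carry p g - total_carry p h = partial_carry p i g - partial_carry p i h"
        using pc[OF s] tc[of 1] by simp
      then have "d' (2 * p + 2) = d' (p + 1 + i) \<longleftrightarrow>
          (d (2 * p + 2) + (partial_carry p i g - partial_carry p i h)) mod int p
          = (d (p + 1 + i) + (partial_carry p i g - partial_carry p i h)) mod int p"
        using part[OF i] tot by simp
      also have "\<dots> \<longleftrightarrow> d (2 * p + 2) = d (p + 1 + i)"
        using mod_add_right_cancel_int[OF _ d_range d_range] i by fastforce
      finally show ?thesis .
    qed
    then show ?thesis using carr base by (auto simp: counit_fibre_def)
  qed
  have ones: "d \<in> ones_fibre p 0 \<longleftrightarrow> d' \<in> ones_fibre p 1"
  proof -
    have "(\<Sum>i<p + 1. d (p + 1 + i)) mod int p = 0 \<longleftrightarrow> (\<Sum>i<p + 1. d' (p + 1 + i)) mod int p = 1"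
      if b: "\<forall>j<p + 1. d j = 1"
    proof -
      let ?M = "\<Sum>j<p + 1. m j"
      \<comment> \<open>Leaving out index \<open>i\<close> leaves \<open>p\<close> coordinates equal
        to 1, whence the quotient 1, and omits the borrow term \<open>m i\<close>.\<close>
      have step: "d' (p + 1 + i) = (d (p + 1 + i) + (1 + ?M - m i)) mod int p" if i: "i < p + 1" for i
      proof -
        have "(\<Sum>j\<in>{..<p + 1} - {i}. d j) = (\<Sum>j\<in>{..<p + 1} - {i}. 1)"
          using b by (intro sum.cong) auto
        then have "(\<Sum>j\<in>{..<p + 1} - {i}. d j) = int p * 1" using i by simp
        from pc[OF this] show ?thesis using part[OF i] remove[OF i, of m] by (simp add: algebra_simps)
      qed
      have "(\<Sum>i<p + 1. d' (p + 1 + i)) mod int p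
          = (\<Sum>i<p + 1. (d (p + 1 + i) + (1 + ?M - m i)) mod int p) mod int p"
        using step by simp
      also have "\<dots> = (\<Sum>i<p + 1. d (p + 1 + i) + (1 + ?M - m i)) mod int p"
        by (rule mod_sum_eq)
      also have "(\<Sum>i<p + 1. d (p + 1 + i) + (1 + ?M - m i))
          = (\<Sum>i<p + 1. d (p + 1 + i)) + ((int p + 1) * (1 + ?M) - ?M)"
        by (simp only: sum.distrib sum_subtractf sum_constant) (simp add: algebra_simps)
      \<comment> \<open>The borrows cancel modulo \<open>p\<close>:
        \<open>(p + 1) * (1 + ?M) - ?M = 1 + p * (1 + ?M)\<close>. The remaining 1 is the shift from
        \<open>c = 0\<close> to \<open>c = 1\<close>.\<close>
      also have "\<dots> = ((\<Sum>i<p + 1. d (p + 1 + i)) + 1) + int p * (1 + ?M)"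
        by (simp only: algebra_simps)
      also have "\<dots> mod int p = ((\<Sum>i<p + 1. d (p + 1 + i)) + 1) mod int p" by simp
      finally have e: "(\<Sum>i<p + 1. d' (p + 1 + i)) mod int p
          = ((\<Sum>i<p + 1. d (p + 1 + i)) + 1) mod int p" .
      have "(a + 1) mod int p = 1 \<longleftrightarrow> a mod int p = 0" for a
      proof -
        have "(a + 1) mod int p = 1 \<longleftrightarrow> (a + 1) mod int p = 1 mod int p" using p by simp
        also have "\<dots> \<longleftrightarrow> a mod int p = 0"
          unfolding mod_eq_dvd_iff by (simp add: dvd_eq_mod_eq_0)
        finally show ?thesis .
      qed
      then show ?thesis unfolding e by simp
    qed
    then show ?thesis using carr base by (auto simp: ones_fibre_def)
  qed
  show ?thesis using unit counit ones by (auto simp: connection_set_def)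
qed

lemma connection_sets_isomorphic:
  assumes "p > 1"
  shows "digraph_iso (cayley_digraph (elem_abelian_group p (2 * p + 3)) (connection_set p 0))
           (cayley_digraph (elem_abelian_group p (2 * p + 3)) (connection_set p 1))"
  unfolding digraph_iso_cayley_digraph_iff
proof (intro exI[of _ "twist p"] conjI ballI)
  show bij: "bij_betw (twist p) (carrier (elem_abelian_group p (2 * p + 3)))
      (carrier (elem_abelian_group p (2 * p + 3)))"
    using assms by (intro bij_betw_twist) simp
  fix g h assume gh: "g \<in> carrier (elem_abelian_group p (2 * p + 3))"
    "h \<in> carrier (elem_abelian_group p (2 * p + 3))"
  then have "twist p g \<in> carrier (elem_abelian_group p (2 * p + 3))"
    "twist p h \<in> carrier (elem_abelian_group p (2 * p + 3))"
    using bij by (auto simp: bij_betw_def)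
  with gh twist_connection_set[OF assms gh]
  show "g \<otimes>\<^bsub>elem_abelian_group p (2 * p + 3)\<^esub> inv\<^bsub>elem_abelian_group p (2 * p + 3)\<^esub> h \<in> connection_set p 0
    \<longleftrightarrow> twist p g \<otimes>\<^bsub>elem_abelian_group p (2 * p + 3)\<^esub> inv\<^bsub>elem_abelian_group p (2 * p + 3)\<^esub> twist p h
      \<in> connection_set p 1"
    by (simp add: diff_elem_abelian_group)
qed


section \<open>Nonexistence of a group automorphism\<close>

lemma connection_set_base: "x \<in> connection_set p c \<Longrightarrow> j < p + 1 \<Longrightarrow> x j \<in> {0, 1}"
  by (auto simp: connection_set_def unit_fibre_def counit_fibre_def ones_fibre_def
      base_unit_def base_counit_def)

text \<open>The base points of the fibres are distinct, so the base coordinates alone decide the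
  fibre; the next two lemmas treat the other two kinds.\<close>

lemma connection_set_unitD:
  assumes "p > 1" "x \<in> connection_set p c" "\<And>j. j < p + 1 \<Longrightarrow> x j = base_unit i j" "i < p + 1"
  shows "x \<in> unit_fibre p i"
proof -
  have "x \<notin> counit_fibre p i'" for i'
    using assms(3) base_unit_neq_counit[OF assms(1), of i i'] by (auto simp: counit_fibre_def)
  moreover have "x \<notin> ones_fibre p c"
    using assms base_unit_neq_ones[of p i] by (auto simp: ones_fibre_def)
  moreover have "i' = i" if "x \<in> unit_fibre p i'" for i'
    using that assms(3)[OF assms(4)] assms(4) by (auto simp: unit_fibre_def base_unit_def)
  ultimately show ?thesis using assms(2) by (auto simp: connection_set_def)
qed

lemma connection_set_counitD:
  assumes "p > 1" "x \<in> connection_set p c" "\<And>j. j < p + 1 \<Longrightarrow> x j = base_counit i j" "i < p + 1"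
  shows "x \<in> counit_fibre p i"
proof -
  have "x \<notin> unit_fibre p i'" for i'
    using assms(3) base_unit_neq_counit[OF assms(1), of i' i] by (auto simp: unit_fibre_def)
  moreover have "x \<notin> ones_fibre p c"
    using assms(3)[OF assms(4)] assms(4) by (auto simp: ones_fibre_def base_counit_def)
  moreover have "i' = i" if "x \<in> counit_fibre p i'" "i' < p + 1" for i'
    using that assms(3)[OF that(2)] by (auto simp: counit_fibre_def base_counit_def split: if_splits)
  ultimately show ?thesis using assms(2) by (auto simp: connection_set_def)
qed

lemma connection_set_onesD:
  assumes "p > 1" "x \<in> connection_set p c" "\<And>j. j < p + 1 \<Longrightarrow> x j = 1"
  shows "x \<in> ones_fibre p c"
proof -
  have "x \<notin> unit_fibre p i" for i
    using assms base_unit_neq_ones[of p i] by (auto simp: unit_fibre_def)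
  moreover have "x \<notin> counit_fibre p i" if "i < p + 1" for i
    using assms(3)[OF that] that by (auto simp: counit_fibre_def base_counit_def)
  ultimately show ?thesis using assms(2) by (auto simp: connection_set_def)
qed

text \<open>With \<open>d\<close> nonzero, the progression is 0, 1, 2 if \<open>c + d\<close> does
  not wrap around, and 1, 0, \<open>p - 1\<close> if it does. The last term is outside
  \<open>{0, 1}\<close> because \<open>p > 2\<close>.\<close>

lemma no_progression_in_01:
  fixes c d :: int
  assumes "p > 2" "0 \<le> d" "d < int p"
    and "c \<in> {0, 1}" "(c + d) mod int p \<in> {0, 1}" "((c + d) mod int p + d) mod int p \<in> {0, 1}"
  shows "d = 0"
proof (cases "c + d < int p")
  case True
  then have e: "(c + d) mod int p = c + d"
    using assms(2,4) by (intro mod_pos_pos_trivial) auto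
  have "d = 0 \<or> c + d = 1 \<and> d = 1" using assms(2,4,5) unfolding e by auto
  moreover have "(1 + 1) mod int p = 2" using assms(1) by simp
  ultimately show ?thesis using assms(6) unfolding e by auto
next
  case False
  then have d: "c + d = int p" "d = int p - 1" using assms(3,4) by auto
  have "(int p - 1) mod int p = int p - 1" using assms(1) by (intro mod_pos_pos_trivial) auto
  then show ?thesis using assms(1,6) unfolding d(1) by (simp add: d(2))
qed

lemma no_automorphism_between_connection_sets:
  assumes p: "p > 2"
    and \<sigma>: "\<sigma> \<in> iso (elem_abelian_group p (2 * p + 3)) (elem_abelian_group p (2 * p + 3))"
    and im: "\<sigma> ` connection_set p 0 = connection_set p 1"
  shows False
proof -
  define G where "G = elem_abelian_group p (2 * p + 3)"
  define N where "N = 2 * p + 3"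
  have p0: "p > 0" and p1: "p > 1" using p by auto
  interpret group G unfolding G_def by (rule group_elem_abelian_group)
  have carr: "x \<in> carrier G \<longleftrightarrow> x \<in> {..<N} \<rightarrow>\<^sub>E {0..<int p}" for x
    using p0 by (simp add: G_def N_def carrier_elem_abelian_group)
  have nth: "0 \<le> x j" "x j < int p" if "x \<in> carrier G" "j < N" for x j
    using that elem_abelian_group_nth[OF p0] by (auto simp: G_def N_def)
  have mult_nth: "(x \<otimes>\<^bsub>G\<^esub> y) j = (x j + y j) mod int p" if "j < N" for x y j
    using that by (simp add: G_def N_def mult_elem_abelian_group)
  have eqI: "x = y" if "x \<in> carrier G" "y \<in> carrier G" "\<And>j. j < N \<Longrightarrow> x j = y j" for x y
    using elem_abelian_group_eqI[OF p0] that by (simp add: G_def N_def)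
  have gh: "group_hom G G \<sigma>"
    using \<sigma> is_group by (simp add: group_hom_def group_hom_axioms_def iso_def G_def)
  have hom: "\<sigma> (x \<otimes>\<^bsub>G\<^esub> y) = \<sigma> x \<otimes>\<^bsub>G\<^esub> \<sigma> y" if "x \<in> carrier G" "y \<in> carrier G" for x y
    by (rule group_hom.hom_mult[OF gh that])
  have inj: "inj_on \<sigma> (carrier G)" and surj: "\<sigma> ` carrier G = carrier G"
    using \<sigma> by (auto simp: iso_def bij_betw_def G_def)
  have closed: "\<sigma> x \<in> carrier G" if "x \<in> carrier G" for x
    using surj that by blast
  have S_sub: "connection_set p c \<subseteq> carrier G" for c
    using connection_set_subset by (simp add: G_def)

  \<comment> \<open>\<open>V\<close> is the fibre over 0, and \<open>K\<close> is its complement on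
    which all fibre coordinates vanish.\<close>
  define V where "V = {x \<in> carrier G. \<forall>j<p + 1. x j = 0}"
  define K where "K = {x \<in> carrier G. \<forall>j. p + 1 \<le> j \<longrightarrow> j < N \<longrightarrow> x j = 0}"
  \<comment> \<open>Translation by such a \<open>v\<close> preserves \<open>unit_fibre p i\<close>.
    Hence \<open>g\<close>, \<open>g + v\<close> and \<open>g + 2v\<close> all map into
    \<open>connection_set p 1\<close>, and each base coordinate of their images is a progression in
    \<open>{0, 1}\<close>.\<close>
  have V_partial: "\<sigma> v \<in> V" if v: "v \<in> V" and i: "i < p + 1" "v (p + 1 + i) = 0" for v i
  proof -
    define g where "g = (\<lambda>j\<in>{..<N}. if j < p + 1 then base_unit i j else 0)"
    have vc: "v \<in> carrier G" using v by (simp add: V_def)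
    have g: "g \<in> unit_fibre p i"
      using p i by (auto simp: g_def unit_fibre_def carr[unfolded G_def] base_unit_def N_def)
    have add: "h \<otimes>\<^bsub>G\<^esub> v \<in> unit_fibre p i" if h: "h \<in> unit_fibre p i" for h
    proof -
      have "h \<in> carrier G" using h by (simp add: unit_fibre_def G_def)
      then have "h \<otimes>\<^bsub>G\<^esub> v \<in> carrier G" using vc by simp
      moreover have "(h \<otimes>\<^bsub>G\<^esub> v) j = base_unit i j" if "j < p + 1" for j
        using h v that p by (simp add: mult_nth N_def unit_fibre_def V_def base_unit_def)
      moreover have "(h \<otimes>\<^bsub>G\<^esub> v) (p + 1 + i) = 0"
        using h i by (simp add: mult_nth N_def unit_fibre_def)
      ultimately show ?thesis by (simp add: unit_fibre_def G_def)
    qed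
    have img: "\<sigma> h \<in> connection_set p 1" if "h \<in> unit_fibre p i" for h
    proof -
      have "h \<in> connection_set p 0" using that i by (auto simp: connection_set_def)
      then show ?thesis using im by blast
    qed
    have gc: "g \<in> carrier G" using g by (simp add: unit_fibre_def G_def)
    have "\<sigma> v j = 0" if j: "j < p + 1" for j
    proof (rule no_progression_in_01[OF p, of _ "\<sigma> g j"])
      have jN: "j < N" using j by (simp add: N_def)
      show "0 \<le> \<sigma> v j" "\<sigma> v j < int p" using nth[OF closed[OF vc] jN] by auto
      show "\<sigma> g j \<in> {0, 1}" by (rule connection_set_base[OF img[OF g] j])
      show "(\<sigma> g j + \<sigma> v j) mod int p \<in> {0, 1}"
        using connection_set_base[OF img[OF add[OF g]] j] by (simp add: hom gc vc mult_nth jN)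
      show "((\<sigma> g j + \<sigma> v j) mod int p + \<sigma> v j) mod int p \<in> {0, 1}"
        using connection_set_base[OF img[OF add[OF add[OF g]]] j]
        by (simp add: hom gc vc mult_nth jN)
    qed
    then show ?thesis using closed[OF vc] by (simp add: V_def)
  qed
  have V_closed: "\<sigma> v \<in> V" if v: "v \<in> V" for v
  proof -
    \<comment> \<open>Each summand has a vanishing fibre coordinate: \<open>v1\<close> at index
      \<open>p + 1\<close>, so it preserves the fibre over unit vector 0, and \<open>v2\<close> at
      index \<open>p + 2\<close>, so it preserves the one over unit vector 1.\<close>
    define v1 where "v1 = (\<lambda>j\<in>{..<N}. if j = p + 1 then 0 else v j)"
    define v2 where "v2 = (\<lambda>j\<in>{..<N}. if j = p + 1 then v j else 0)"
    have vc: "v \<in> carrier G" using v by (simp add: V_def)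
    have v1: "v1 \<in> V" using v p by (auto simp: V_def v1_def carr PiE_iff N_def)
    have v2: "v2 \<in> V" using v p by (auto simp: V_def v2_def carr PiE_iff N_def)
    have "\<sigma> v1 \<in> V" by (rule V_partial[OF v1, of 0]) (auto simp: v1_def N_def)
    moreover have "\<sigma> v2 \<in> V" by (rule V_partial[OF v2, of 1]) (use p in \<open>auto simp: v2_def N_def\<close>)
    moreover have "v = v1 \<otimes>\<^bsub>G\<^esub> v2"
    proof (rule eqI)
      show "v1 \<otimes>\<^bsub>G\<^esub> v2 \<in> carrier G" using v1 v2 by (simp add: V_def)
      show "v j = (v1 \<otimes>\<^bsub>G\<^esub> v2) j" if "j < N" for j
        using nth[OF vc that] that by (auto simp: mult_nth v1_def v2_def)
    qed (rule vc)
    then have "\<sigma> v = \<sigma> v1 \<otimes>\<^bsub>G\<^esub> \<sigma> v2" using v1 v2 by (simp add: hom V_def)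
    ultimately show ?thesis by (simp add: V_def mult_nth N_def)
  qed
  have V_image: "\<sigma> ` V = V"
  proof (rule endo_inj_surj)
    show "finite V" unfolding V_def G_def using finite_carrier_elem_abelian_group[OF p0] by simp
    show "\<sigma> ` V \<subseteq> V" using V_closed by blast
    show "inj_on \<sigma> V" using inj by (rule inj_on_subset) (auto simp: V_def)
  qed

  have K_one: "\<one>\<^bsub>G\<^esub> \<in> K" by (simp add: K_def) (simp add: G_def one_elem_abelian_group N_def)
  have K_mult: "x \<otimes>\<^bsub>G\<^esub> y \<in> K" if "x \<in> K" "y \<in> K" for x y
    using that by (simp add: K_def mult_nth)
  have im_one: "\<one>\<^bsub>G\<^esub> \<in> \<sigma> ` K"
  proof -
    have "\<sigma> \<one>\<^bsub>G\<^esub> = \<one>\<^bsub>G\<^esub>"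
      by (rule group_hom.hom_one[OF gh])
    then show ?thesis using K_one by force
  qed
  have im_mult: "x \<otimes>\<^bsub>G\<^esub> y \<in> \<sigma> ` K" if "x \<in> \<sigma> ` K" "y \<in> \<sigma> ` K" for x y
  proof -
    obtain u w where "u \<in> K" "x = \<sigma> u" "w \<in> K" "y = \<sigma> w" using \<open>x \<in> _\<close> \<open>y \<in> _\<close> by blast
    then have "x \<otimes>\<^bsub>G\<^esub> y = \<sigma> (u \<otimes>\<^bsub>G\<^esub> w)" "u \<otimes>\<^bsub>G\<^esub> w \<in> K"
      using hom K_mult by (auto simp: K_def)
    then show ?thesis by blast
  qed
  have im_carrier: "x \<in> carrier G" if "x \<in> \<sigma> ` K" for x
    using that closed by (auto simp: K_def)
  \<comment> \<open>\<open>\<sigma> ` K\<close> is a complement of \<open>V\<close>, so its elements are determined by their base coordinates.\<close>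
  have im_eq: "k = k'" if k: "k \<in> \<sigma> ` K" "k' \<in> \<sigma> ` K" and eq: "\<And>j. j < p + 1 \<Longrightarrow> k j = k' j" for k k'
  proof -
    obtain u u' where u: "u \<in> K" "k = \<sigma> u" "u' \<in> K" "k' = \<sigma> u'" using k by blast
    then have uc: "u \<in> carrier G" "u' \<in> carrier G" by (auto simp: K_def)
    have diff: "x \<otimes>\<^bsub>G\<^esub> inv\<^bsub>G\<^esub> y = (\<lambda>j\<in>{..<N}. (x j - y j) mod int p)"
      if "x \<in> carrier G" "y \<in> carrier G" for x y
      using that unfolding G_def N_def by (rule diff_elem_abelian_group)
    let ?w = "u \<otimes>\<^bsub>G\<^esub> inv\<^bsub>G\<^esub> u'"
    have "\<sigma> ?w = k \<otimes>\<^bsub>G\<^esub> inv\<^bsub>G\<^esub> k'"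
    proof -
      have "\<sigma> (inv\<^bsub>G\<^esub> u') = inv\<^bsub>G\<^esub> (\<sigma> u')"
        by (rule group_hom.hom_inv[OF gh uc(2)])
      then show ?thesis using u uc by (simp add: hom)
    qed
    also have "\<dots> \<in> V"
    proof -
      have "k \<otimes>\<^bsub>G\<^esub> inv\<^bsub>G\<^esub> k' \<in> carrier G" using k im_carrier by simp
      moreover have "(k \<otimes>\<^bsub>G\<^esub> inv\<^bsub>G\<^esub> k') j = 0" if "j < p + 1" for j
        using that eq k im_carrier by (simp add: diff N_def)
      ultimately show ?thesis by (simp add: V_def)
    qed
    finally have "\<sigma> ?w \<in> \<sigma> ` V" by (simp add: V_image)
    then have "?w \<in> V"
      using inj uc by (auto simp: V_def dest!: inj_onD[of \<sigma> "carrier G"])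
    then have z: "(u j - u' j) mod int p = 0" if "j < p + 1" for j
      using that uc by (simp add: V_def diff N_def)
    have "u = u'"
    proof (rule eqI[OF uc])
      fix j assume j: "j < N"
      show "u j = u' j"
      proof (cases "j < p + 1")
        case True
        then have "u j mod int p = u' j mod int p"
          using z by (simp add: mod_eq_dvd_iff dvd_eq_mod_eq_0)
        then show ?thesis using nth[OF uc(1) j] nth[OF uc(2) j] by simp
      next
        case False
        then show ?thesis using u j by (simp add: K_def)
      qed
    qed
    then show ?thesis using u by simp
  qed

  \<comment> \<open>The equations of \<open>connection_set p 0\<close> are homogeneous in the fibre
    coordinates, so setting these to 0 in a preimage of \<open>t\<close> stays in the set. The
    discarded part lies in \<open>V\<close> and cannot affect the base of the image.\<close>
  have meets: "\<exists>k \<in> \<sigma> ` K. k \<in> connection_set p 1 \<and> (\<forall>j<p + 1. k j = t j)"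
    if t: "t \<in> connection_set p 1" for t
  proof -
    obtain g where g: "g \<in> connection_set p 0" "t = \<sigma> g" using im t by blast
    then have gc: "g \<in> carrier G" using S_sub by blast
    define u where "u = (\<lambda>j\<in>{..<N}. if j < p + 1 then g j else 0)"
    define v where "v = (\<lambda>j\<in>{..<N}. if j < p + 1 then 0 else g j)"
    have u: "u \<in> K" using gc p by (auto simp: K_def u_def carr PiE_iff N_def)
    have v: "v \<in> V" using gc p by (auto simp: V_def v_def carr PiE_iff N_def)
    have uc: "u \<in> carrier G" and vc: "v \<in> carrier G" using u v by (auto simp: K_def V_def)
    have u_base: "u j = g j" if "j < p + 1" for j using that by (simp add: u_def N_def)
    have u_top: "u j = 0" if "p + 1 \<le> j" "j < N" for j using that by (simp add: u_def)
    have "u \<in> connection_set p 0"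
      using g(1) uc u_base u_top
      by (auto simp: connection_set_def unit_fibre_def counit_fibre_def ones_fibre_def G_def N_def)
    then have "\<sigma> u \<in> connection_set p 1" using im by blast
    moreover have "g = u \<otimes>\<^bsub>G\<^esub> v"
    proof (rule eqI[OF gc])
      show "u \<otimes>\<^bsub>G\<^esub> v \<in> carrier G" using uc vc by simp
      show "g j = (u \<otimes>\<^bsub>G\<^esub> v) j" if "j < N" for j
        using nth[OF gc that] that by (auto simp: mult_nth u_def v_def)
    qed
    then have "t = \<sigma> u \<otimes>\<^bsub>G\<^esub> \<sigma> v" using g uc vc by (simp add: hom)
    then have "\<sigma> u j = t j" if "j < p + 1" for j
      using that V_closed[OF v] nth[OF closed[OF uc], of j] by (simp add: mult_nth N_def V_def)
    ultimately show ?thesis using u by blast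
  qed
  \<comment> \<open>Explicit test points for \<open>meets\<close>. The flag \<open>b\<close> puts a
    1 at index \<open>p + 1\<close>, which gives the fibre over the all-ones vector its coordinate
    sum 1.\<close>
  have meets': "\<exists>k \<in> \<sigma> ` K. k \<in> connection_set p 1 \<and> (\<forall>j<p + 1. k j = a j)"
    if "(\<lambda>j\<in>{..<N}. if j < p + 1 then a j else of_bool (j = p + 1 \<and> b)) \<in> connection_set p 1"
      for a :: "nat \<Rightarrow> int" and b
    using meets[OF that] by (auto simp: N_def)

  have "\<exists>k \<in> \<sigma> ` K. k \<in> unit_fibre p i" if i: "i < p + 1" for i
  proof -
    have "(\<lambda>j\<in>{..<N}. if j < p + 1 then base_unit i j else of_bool (j = p + 1 \<and> False)) \<in> unit_fibre p i"
      using p i by (auto simp: unit_fibre_def carr[unfolded G_def] base_unit_def N_def)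
    then have "\<exists>k \<in> \<sigma> ` K. k \<in> connection_set p 1 \<and> (\<forall>j<p + 1. k j = base_unit i j)"
      using i by (intro meets'[of _ False]) (auto simp: connection_set_def)
    then show ?thesis using connection_set_unitD[OF p1 _ _ i] by blast
  qed
  then obtain ke where ke: "\<And>i. i < p + 1 \<Longrightarrow> ke i \<in> \<sigma> ` K \<and> ke i \<in> unit_fibre p i" by metis
  have "\<exists>k \<in> \<sigma> ` K. k \<in> counit_fibre p i" if i: "i < p + 1" for i
  proof -
    have "(\<lambda>j\<in>{..<N}. if j < p + 1 then base_counit i j else of_bool (j = p + 1 \<and> False)) \<in> counit_fibre p i"
      using p i by (auto simp: counit_fibre_def carr[unfolded G_def] base_counit_def N_def)
    then have "\<exists>k \<in> \<sigma> ` K. k \<in> connection_set p 1 \<and> (\<forall>j<p + 1. k j = base_counit i j)"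
      using i by (intro meets'[of _ False]) (auto simp: connection_set_def)
    then show ?thesis using connection_set_counitD[OF p1 _ _ i] by blast
  qed
  then obtain kc where kc: "\<And>i. i < p + 1 \<Longrightarrow> kc i \<in> \<sigma> ` K \<and> kc i \<in> counit_fibre p i" by metis
  obtain ks where ks: "ks \<in> \<sigma> ` K" "ks \<in> ones_fibre p 1"
  proof -
    let ?t = "\<lambda>j\<in>{..<N}. if j < p + 1 then 1 else of_bool (j = p + 1 \<and> True) :: int"
    have "(\<Sum>i<p + 1. ?t (p + 1 + i)) = (\<Sum>i<p + 1. of_bool (i = 0))"
      by (intro sum.cong) (auto simp: N_def)
    also have "\<dots> = 1" by (simp add: of_bool_def)
    finally have "(\<Sum>i<p + 1. ?t (p + 1 + i)) mod int p = 1" using p by simp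
    then have "?t \<in> ones_fibre p 1"
      using p unfolding ones_fibre_def
      by (intro CollectI conjI) (auto simp: carr[unfolded G_def N_def] N_def)
    then have "\<exists>k \<in> \<sigma> ` K. k \<in> connection_set p 1 \<and> (\<forall>j<p + 1. k j = 1)"
      by (intro meets'[of _ True]) (auto simp: connection_set_def)
    then show ?thesis using connection_set_onesD[OF p1] that by blast
  qed

  \<comment> \<open>Both sides lie in the complement and have all base coordinates 1, so
    \<open>im_eq\<close> identifies all their coordinates; \<open>unit_counit\<close> uses the same
    argument.\<close>
  have sum_units: "ks = (\<lambda>j\<in>{..<N}. (\<Sum>i<p + 1. ke i j) mod int p)"
  proof (rule im_eq[OF ks(1)])
    show "(\<lambda>j\<in>{..<N}. (\<Sum>i<p + 1. ke i j) mod int p) \<in> \<sigma> ` K"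
      unfolding N_def by (rule sum_mem_of_mult_closed) (use im_one im_mult ke in \<open>auto simp: G_def\<close>)
    fix j assume j: "j < p + 1"
    have "(\<Sum>i<p + 1. ke i j) = (\<Sum>i<p + 1. of_bool (i = j))"
      using ke j by (intro sum.cong) (auto simp: unit_fibre_def base_unit_def)
    also have "\<dots> = 1" using j by (simp add: of_bool_def)
    finally show "ks j = (\<lambda>j\<in>{..<N}. (\<Sum>i<p + 1. ke i j) mod int p) j"
      using j p ks(2) by (simp add: N_def ones_fibre_def)
  qed
  have unit_counit: "ks = kc i \<otimes>\<^bsub>G\<^esub> ke i" if i: "i < p + 1" for i
  proof (rule im_eq[OF ks(1)])
    show "kc i \<otimes>\<^bsub>G\<^esub> ke i \<in> \<sigma> ` K" using ke kc i by (intro im_mult) auto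
    show "ks j = (kc i \<otimes>\<^bsub>G\<^esub> ke i) j" if "j < p + 1" for j
      using that p ks(2) ke[OF i] kc[OF i]
      by (simp add: mult_nth N_def ones_fibre_def unit_fibre_def counit_fibre_def
          base_unit_def base_counit_def)
  qed
  define a where "a = ks (2 * p + 2)"
  \<comment> \<open>At index \<open>p + 1 + i\<close> the point \<open>ke i\<close> is 0 and
    \<open>kc i\<close> equals its own last coordinate; the last coordinate of
    \<open>unit_counit\<close> then eliminates \<open>kc i\<close>.\<close>
  have z: "ks (p + 1 + i) mod int p = (a - ke i (2 * p + 2)) mod int p" if i: "i < p + 1" for i
  proof -
    have kci: "kc i \<in> carrier G" using kc[OF i] im_carrier by blast
    have iN: "p + 1 + i < N" using i by (simp add: N_def)
    have "ks (p + 1 + i) = (kc i (p + 1 + i) + ke i (p + 1 + i)) mod int p"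
      unfolding unit_counit[OF i] by (rule mult_nth[OF iN])
    also have "\<dots> = kc i (2 * p + 2)"
      using ke[OF i] kc[OF i] nth[OF kci iN] by (simp add: unit_fibre_def counit_fibre_def)
    finally have "ks (p + 1 + i) = kc i (2 * p + 2)" .
    moreover have "a = (kc i (2 * p + 2) + ke i (2 * p + 2)) mod int p"
      unfolding a_def unit_counit[OF i] by (rule mult_nth) (simp add: N_def)
    ultimately show ?thesis by (simp add: mod_diff_left_eq)
  qed
  have "1 = (\<Sum>i<p + 1. ks (p + 1 + i)) mod int p"
    using ks(2) by (simp add: ones_fibre_def)
  also have "\<dots> = (\<Sum>i<p + 1. ks (p + 1 + i) mod int p) mod int p"
    by (rule mod_sum_eq[symmetric])
  also have "\<dots> = (\<Sum>i<p + 1. (a - ke i (2 * p + 2)) mod int p) mod int p"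
    using z by simp
  also have "\<dots> = (\<Sum>i<p + 1. a - ke i (2 * p + 2)) mod int p"
    by (rule mod_sum_eq)
  \<comment> \<open>Of the \<open>p + 1\<close> copies of \<open>a\<close>, \<open>p\<close> vanish
    modulo \<open>p\<close>; the last one cancels against the sum by the final coordinate of
    \<open>sum_units\<close>.\<close>
  also have "(\<Sum>i<p + 1. a - ke i (2 * p + 2)) = (a - (\<Sum>i<p + 1. ke i (2 * p + 2))) + a * int p"
    by (simp only: sum_subtractf sum_constant) (simp add: algebra_simps)
  also have "\<dots> mod int p = (a - (\<Sum>i<p + 1. ke i (2 * p + 2))) mod int p" by simp
  also have "\<dots> = 0"
  proof -
    have "a = (\<Sum>i<p + 1. ke i (2 * p + 2)) mod int p"
      unfolding a_def by (subst sum_units) (simp add: N_def)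
    then show ?thesis by (simp only: mod_diff_left_eq) simp
  qed
  finally show False by simp
qed

theorem theorem1:
  fixes p :: nat
  assumes "prime p" and "p > 2"
  shows "\<exists>S \<subseteq> carrier (elem_abelian_group p (2 * p + 3)).
           card S = (2 * p + 3) * p ^ (p + 1) \<and>
           \<not> is_CI_graph (elem_abelian_group p (2 * p + 3)) S"
proof (intro exI[of _ "connection_set p 0"] conjI)
  show "connection_set p 0 \<subseteq> carrier (elem_abelian_group p (2 * p + 3))"
    by (rule connection_set_subset)
  show "card (connection_set p 0) = (2 * p + 3) * p ^ (p + 1)"
    using assms by (intro card_connection_set) simp
  show "\<not> is_CI_graph (elem_abelian_group p (2 * p + 3)) (connection_set p 0)"
  proof
    assume "is_CI_graph (elem_abelian_group p (2 * p + 3)) (connection_set p 0)"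
    moreover have "digraph_iso (cayley_digraph (elem_abelian_group p (2 * p + 3)) (connection_set p 0))
        (cayley_digraph (elem_abelian_group p (2 * p + 3)) (connection_set p 1))"
      using assms by (intro connection_sets_isomorphic) simp
    ultimately obtain \<sigma>
      where "\<sigma> \<in> iso (elem_abelian_group p (2 * p + 3)) (elem_abelian_group p (2 * p + 3))"
        and "\<sigma> ` connection_set p 0 = connection_set p 1"
      using connection_set_subset[of p 1] unfolding is_CI_graph_def by meson
    then show False by (rule no_automorphism_between_connection_sets[OF assms(2)])
  qed
qed

end
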